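(* Let $\mu$ be a Borel probability measure on $\mathbb{R}$ with all moments finite and with infinitely many points of increase, and let $P=\{p_n\}_{n\in\mathbb{Z}_+}$ be a system of orthonormal polynomials with respect to $\mathrm{d}\mu$ (real polynomials, $\deg p_n=n$). Let $g\in \mathrm{L}_2(\mathbb{R})$, not almost everywhere zero, be a (complex-valued) function such that $|\xi^n g(\xi)|\to 0$ as $|\xi|\to\infty$ for every integer $n\ge 0$, and let $\{\theta_n\}_{n\in\mathbb{Z}_+}\subset[0,2\pi)$. Define $\Phi=\{\varphi_n\}_{n\in\mathbb{Z}_+}\subset \mathrm{L}_2(\mathbb{R})$ by $$\varphi_n(x)=\frac{\mathrm{e}^{\mathrm{i}\theta_n}}{\sqrt{2\pi}}\int_{-\infty}^{\infty}\mathrm{e}^{\mathrm{i}x\xi}\,p_n(\xi)\,g(\xi)\,\mathrm{d}\xi,\qquad x\in\mathbb{R},\ n\in\mathbb{Z}_+.$$ Then $\Phi$ is orthogonal in $\mathrm{L}_2(\mathbb{R})$ if and only if $P$ is orthogonal with respect to the measure $|g(\xi)|^2\,\mathrm{d}\xi$. Furthermore, whenever $\Phi$ is orthogonal, the functions $\varphi_n/\|g\|_2$, $n\in\mathbb{Z}_+$, are orthonormal in $\mathrm{L}_2(\mathbb{R})$.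
   Context: $\mathbb{Z}_+=\{0,1,2,\ldots\}$. $\mathrm{L}_2(\mathbb{R})$ is the space of complex-valued square-integrable functions with the inner product $\int_{-\infty}^\infty \overline{f(x)}\,h(x)\,\mathrm{d}x$, and $\|g\|_2=\left(\int_{-\infty}^\infty|g(\xi)|^2\,\mathrm{d}\xi\right)^{1/2}$. "Infinitely many points of increase" means that the support of $\mu$ is an infinite set. Orthonormality of $P$ with respect to $\mathrm{d}\mu$ means $\int p_m p_n\,\mathrm{d}\mu=\delta_{m,n}$ for all $m,n$. "Orthogonal" (for $\Phi$, or for $P$ with respect to $|g(\xi)|^2\mathrm{d}\xi$) means that the inner product of any two members with distinct indices vanishes, i.e. $\int_{-\infty}^\infty\overline{\varphi_n}\varphi_m\,\mathrm{d}x=0$, respectively $\int_{-\infty}^\infty p_m(\xi)p_n(\xi)|g(\xi)|^2\,\mathrm{d}\xi=0$, for all $m\neq n$. *)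

theory Defs
  imports "HOL-Probability.Probability"
begin

text \<open>Elements of \<open>L2_space\<close> are functions rather than classes modulo null sets, because the
  decay condition on \<open>g\<close> is pointwise.\<close>

definition L2_space :: "(real \<Rightarrow> complex) set" where
  "L2_space = {f \<in> borel_measurable lebesgue. integrable lebesgue (\<lambda>x. (cmod (f x))\<^sup>2)}"

definition L2_inner :: "(real \<Rightarrow> complex) \<Rightarrow> (real \<Rightarrow> complex) \<Rightarrow> complex" where
  "L2_inner f h = (LINT x|lebesgue. cnj (f x) * h x)"

definition L2_nrm :: "(real \<Rightarrow> complex) \<Rightarrow> real" where
  "L2_nrm f = sqrt (LINT x|lebesgue. (cmod (f x))\<^sup>2)"

definition orthogonal_family :: "(nat \<Rightarrow> real \<Rightarrow> complex) \<Rightarrow> bool" where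
  "orthogonal_family \<phi> \<longleftrightarrow> (\<forall>m n. m \<noteq> n \<longrightarrow> L2_inner (\<phi> m) (\<phi> n) = 0)"

definition orthonormal_family :: "(nat \<Rightarrow> real \<Rightarrow> complex) \<Rightarrow> bool" where
  "orthonormal_family \<phi> \<longleftrightarrow> (\<forall>m n. L2_inner (\<phi> m) (\<phi> n) = (if m = n then 1 else 0))"

definition measure_support :: "real measure \<Rightarrow> real set" where
  "measure_support M = {x. \<forall>U. open U \<and> x \<in> U \<longrightarrow> emeasure M U > 0}"

definition orthogonal_polys :: "real measure \<Rightarrow> (nat \<Rightarrow> real poly) \<Rightarrow> bool" where
  "orthogonal_polys M p \<longleftrightarrow>
     (\<forall>m n. m \<noteq> n \<longrightarrow> (LINT x|M. poly (p m) x * poly (p n) x) = 0)"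

definition orthonormal_polys :: "real measure \<Rightarrow> (nat \<Rightarrow> real poly) \<Rightarrow> bool" where
  "orthonormal_polys M p \<longleftrightarrow>
     (\<forall>m n. (LINT x|M. poly (p m) x * poly (p n) x) = (if m = n then 1 else 0))"

definition fourier_family ::
  "(nat \<Rightarrow> real poly) \<Rightarrow> (real \<Rightarrow> complex) \<Rightarrow> (nat \<Rightarrow> real) \<Rightarrow> nat \<Rightarrow> real \<Rightarrow> complex" where
  "fourier_family p g \<theta> n x =
     exp (\<i> * complex_of_real (\<theta> n)) / complex_of_real (sqrt (2 * pi)) *
     (LINT \<xi>|lebesgue. exp (\<i> * complex_of_real (x * \<xi>)) * complex_of_real (poly (p n) \<xi>) * g \<xi>)"

end

theory Submission
  imports Defs "HOL-Real_Asymp.Real_Asymp"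
begin

text \<open>
  Each \<open>p\<^sub>n g\<close> lies in \<open>L\<^sub>1 \<inter> L\<^sub>2\<close>, so Parseval's identity turns the inner products of the
  \<open>\<phi>\<^sub>n\<close> into the integrals of \<open>p\<^sub>m p\<^sub>n |g|\<^sup>2\<close>, up to unimodular factors; this is the equivalence.
  If both \<open>\<mu>\<close> and \<open>|g|\<^sup>2 d\<xi>\<close> make the \<open>p\<^sub>n\<close> orthogonal, then integration against either measure
  annihilates \<open>p\<^sub>n\<close> for \<open>n \<ge> 1\<close>. As the \<open>p\<^sub>n\<close> span all polynomials, the two functionals agree
  on polynomials up to the factor \<open>\<parallel>g\<parallel>\<^sup>2\<close>, which gives the norms of the \<open>\<phi>\<^sub>n\<close>.

  Plancherel's theorem on \<open>L\<^sub>1 \<inter> L\<^sub>2\<close> is obtained by Gaussian regularisation: weighting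
  \<open>|F f|\<^sup>2\<close> by a dilated Gaussian and applying Fubini yields the Gaussian average of the autocorrelation
  of \<open>f\<close>, whose real part at \<open>t\<close> is \<open>\<parallel>f\<parallel>\<^sup>2 - \<parallel>f(\<cdot> + t) - f\<parallel>\<^sup>2 / 2\<close>. The correction vanishes in the limit
  because translation is continuous in \<open>L\<^sub>2\<close>.
\<close>

section \<open>Continuity of translation in \<open>L\<^sub>2\<close>\<close>

lemma cmod_diff_squared_le: "(cmod (a - b))\<^sup>2 \<le> 2 * ((cmod a)\<^sup>2 + (cmod b)\<^sup>2)"
proof -
  have "(cmod (a - b))\<^sup>2 \<le> (cmod a + cmod b)\<^sup>2"
    by (intro power_mono norm_triangle_ineq4) auto
  also have "\<dots> \<le> 2 * ((cmod a)\<^sup>2 + (cmod b)\<^sup>2)"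
    using sum_squares_bound[of "cmod a" "cmod b"] by (simp add: power2_sum)
  finally show ?thesis .
qed

lemma cmod_diff_squared_bound:
  assumes "cmod a \<le> C" "cmod b \<le> C"
  shows "(cmod (a - b))\<^sup>2 \<le> 4 * C\<^sup>2"
proof -
  have "cmod (a - b) \<le> 2 * C"
    using norm_triangle_ineq4[of a b] assms by linarith
  then have "(cmod (a - b))\<^sup>2 \<le> (2 * C)\<^sup>2"
    by (intro power_mono) auto
  then show ?thesis by (simp add: power_mult_distrib)
qed

lemma borel_measurable_cnj [measurable]: "cnj \<in> borel_measurable borel"
  by (intro borel_measurable_continuous_onI continuous_intros)

lemma integrable_cmod_diff_squared:
  fixes f h :: "'a \<Rightarrow> complex"
  assumes [measurable]: "f \<in> borel_measurable M" "h \<in> borel_measurable M"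
    and "integrable M (\<lambda>x. (cmod (f x))\<^sup>2)" "integrable M (\<lambda>x. (cmod (h x))\<^sup>2)"
  shows "integrable M (\<lambda>x. (cmod (f x - h x))\<^sup>2)"
proof (rule Bochner_Integration.integrable_bound)
  show "integrable M (\<lambda>x. 2 * ((cmod (f x))\<^sup>2 + (cmod (h x))\<^sup>2))"
    using assms by simp
qed (use cmod_diff_squared_le in \<open>auto simp: abs_of_nonneg\<close>)

lemma integrable_cnj_mult:
  fixes f h :: "'a \<Rightarrow> complex"
  assumes [measurable]: "f \<in> borel_measurable M" "h \<in> borel_measurable M"
    and "integrable M (\<lambda>x. (cmod (f x))\<^sup>2)" "integrable M (\<lambda>x. (cmod (h x))\<^sup>2)"
  shows "integrable M (\<lambda>x. cnj (f x) * h x)"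
proof (rule Bochner_Integration.integrable_bound)
  show "integrable M (\<lambda>x. (cmod (f x))\<^sup>2 + (cmod (h x))\<^sup>2)"
    using assms by simp
  have "cmod a * cmod b \<le> (cmod a)\<^sup>2 + (cmod b)\<^sup>2" for a b
    using sum_squares_bound[of "cmod a" "cmod b"] mult_nonneg_nonneg[of "cmod a" "cmod b"]
    unfolding mult.assoc by (simp del: mult_nonneg_nonneg)
  then show "AE x in M. norm (cnj (f x) * h x) \<le> norm ((cmod (f x))\<^sup>2 + (cmod (h x))\<^sup>2)"
    by (auto simp: norm_mult abs_of_nonneg)
qed auto

section \<open>Truncation and approximation by continuous functions of compact support\<close>

text \<open>For \<open>R > 0\<close> the first factor is a trapezoid in \<open>x\<close>, equal to 1
  for \<open>\<bar>x\<bar> \<le> R - 1\<close> and to 0 for \<open>\<bar>x\<bar> \<ge> R\<close>;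
  the second shrinks \<open>z\<close> radially to modulus at most \<open>R\<close>. Both factors are
  continuous, so that truncation respects continuity and pointwise limits, as indicator functions
  would not.\<close>

definition cutoff :: "real \<Rightarrow> real \<Rightarrow> complex \<Rightarrow> complex" where
  "cutoff R x z = of_real (max 0 (min 1 (R - \<bar>x\<bar>)) * (R / max R (cmod z))) * z"

lemma cutoff_le: "R > 0 \<Longrightarrow> cmod (cutoff R x z) \<le> cmod z"
proof -
  assume R: "R > 0"
  have "\<bar>max 0 (min 1 (R - \<bar>x\<bar>)) * (R / max R (cmod z))\<bar> \<le> 1 * 1"
    unfolding abs_mult by (intro mult_mono) (use R in \<open>auto simp: max_def divide_le_eq_1\<close>)
  then show ?thesis
    unfolding cutoff_def norm_mult norm_of_real
    by (metis mult_left_le_one_le mult_1 norm_ge_zero abs_ge_zero)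
qed

lemma cutoff_bound:
  assumes R: "R > 0"
  shows "cmod (cutoff R x z) \<le> R * indicator {-R..R} x"
proof (cases "x \<in> {-R..R}")
  case True
  have "\<bar>max 0 (min 1 (R - \<bar>x\<bar>))\<bar> * (\<bar>R / max R (cmod z)\<bar> * cmod z) \<le> 1 * R"
    by (intro mult_mono) (use R in \<open>auto simp: max_def field_simps\<close>)
  then show ?thesis
    using True unfolding cutoff_def norm_mult norm_of_real abs_mult
    by (simp add: mult_ac)
next
  case False
  then have "max 0 (min 1 (R - \<bar>x\<bar>)) = 0" by auto
  then show ?thesis using R False by (simp add: cutoff_def)
qed

lemma cutoff_eq: "R \<ge> \<bar>x\<bar> + 1 \<Longrightarrow> R \<ge> cmod z \<Longrightarrow> cutoff R x z = z"
  by (auto simp: cutoff_def max_def min_def)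

lemma continuous_cutoff:
  assumes R: "R > 0" and "continuous_on UNIV h"
  shows "continuous_on UNIV (\<lambda>x. cutoff R x (h x))"
proof -
  have "max R (cmod (h x)) \<noteq> 0" for x using R by auto
  then show ?thesis
    unfolding cutoff_def by (intro continuous_intros assms) auto
qed

lemma tendsto_cutoff:
  assumes R: "R > 0" and "h \<longlonglongrightarrow> z"
  shows "(\<lambda>n. cutoff R x (h n)) \<longlonglongrightarrow> cutoff R x z"
proof -
  have "max R (cmod z) \<noteq> 0" using R by auto
  then show ?thesis
    unfolding cutoff_def by (intro tendsto_intros assms) auto
qed

lemma borel_measurable_cutoff [measurable]:
  assumes [measurable]: "h \<in> borel_measurable borel"
  shows "(\<lambda>x. cutoff R x (h x)) \<in> borel_measurable borel"
  unfolding cutoff_def by measurable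

text \<open>Two dominated convergences: first \<open>f\<close> is replaced by its truncation at a
  large level \<open>R\<close>; then \<open>f\<close> is an almost everywhere limit of continuous
  functions, and truncating these at the same level \<open>R\<close> supplies the majorant that they
  need not have themselves.\<close>

lemma L2_dense_continuous_compact_support:
  fixes f :: "real \<Rightarrow> complex"
  assumes [measurable]: "f \<in> borel_measurable borel"
    and f2: "integrable lborel (\<lambda>x. (cmod (f x))\<^sup>2)" and "e > 0"
  obtains h R where "continuous_on UNIV h" "R > 0" "\<And>x. cmod (h x) \<le> R * indicator {-R..R} x"
    "integrable lborel (\<lambda>x. (cmod (h x))\<^sup>2)" "(LINT x|lborel. (cmod (f x - h x))\<^sup>2) < e"
proof -
  have "(\<lambda>n::nat. LINT x|lborel. (cmod (f x - cutoff (real (Suc n)) x (f x)))\<^sup>2)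
      \<longlonglongrightarrow> (LINT x|(lborel::real measure). 0)"
  proof (rule integral_dominated_convergence)
    show "integrable lborel (\<lambda>x. 4 * (cmod (f x))\<^sup>2)" using f2 by simp
    show "AE x in lborel. (\<lambda>n. (cmod (f x - cutoff (real (Suc n)) x (f x)))\<^sup>2) \<longlonglongrightarrow> 0"
    proof (rule AE_I2)
      fix x :: real
      have "eventually (\<lambda>n. real (Suc n) \<ge> max (\<bar>x\<bar> + 1) (cmod (f x))) sequentially"
        by real_asymp
      then have "eventually (\<lambda>n. (cmod (f x - cutoff (real (Suc n)) x (f x)))\<^sup>2 = 0) sequentially"
        by eventually_elim (simp add: cutoff_eq)
      then show "(\<lambda>n. (cmod (f x - cutoff (real (Suc n)) x (f x)))\<^sup>2) \<longlonglongrightarrow> 0"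
        by (rule tendsto_eventually)
    qed
    fix n :: nat
    have "(cmod (f x - cutoff (real (Suc n)) x (f x)))\<^sup>2 \<le> 4 * (cmod (f x))\<^sup>2" for x
      by (intro cmod_diff_squared_bound cutoff_le) auto
    then show "AE x in lborel. norm ((cmod (f x - cutoff (real (Suc n)) x (f x)))\<^sup>2) \<le> 4 * (cmod (f x))\<^sup>2"
      by simp
  qed auto
  then have "eventually (\<lambda>n. (LINT x|lborel. (cmod (f x - cutoff (real (Suc n)) x (f x)))\<^sup>2) < e / 4) sequentially"
    using \<open>e > 0\<close> by (intro order_tendstoD(2)[where y=0]) simp_all
  then obtain n where n: "(LINT x|lborel. (cmod (f x - cutoff (real (Suc n)) x (f x)))\<^sup>2) < e / 4"
    by (auto simp: eventually_sequentially)
  define R where "R = real (Suc n)"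
  have R: "R > 0" by (simp add: R_def)
  \<comment> \<open>\<open>measurable_on\<close> unfolds to pointwise approximation by continuous
    functions off a negligible set, which is the source of the sequence \<open>g\<close>.\<close>
  have "f measurable_on UNIV"
    by (subst measurable_on_iff_borel_measurable)
       (auto intro: measurable_completion simp: lebesgue_on_UNIV_eq)
  then obtain N g where N: "negligible N" and g: "\<And>k::nat. continuous_on UNIV (g k)"
    and lim: "\<And>x. x \<notin> N \<Longrightarrow> (\<lambda>k. g k x) \<longlonglongrightarrow> f x"
    unfolding measurable_on_def by auto
  have [measurable]: "g k \<in> borel_measurable borel" for k
    using g by (rule borel_measurable_continuous_onI)
  have AE: "AE x in lborel. x \<notin> N"
    using N unfolding negligible_iff_null_sets using AE_not_in AE_completion_iff by blast
  \<comment> \<open>The truncation confines both size and support, so this majorant serves for every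
    truncated function, whatever the untruncated one is.\<close>
  let ?b = "\<lambda>x::real. R\<^sup>2 * indicator {-R..R} x :: real"
  have b: "integrable lborel ?b"
    by (intro integrable_mult_right integrable_real_indicator) (auto simp: emeasure_lborel_Icc_eq)
  have cb: "(cmod (cutoff R x z))\<^sup>2 \<le> ?b x" for x z
    using power_mono[OF cutoff_bound[OF R, of x z] norm_ge_zero, of 2]
    by (simp add: power_mult_distrib split: split_indicator_asm split_indicator)
  have int: "integrable lborel (\<lambda>x. (cmod (cutoff R x (u x)))\<^sup>2)"
    if [measurable]: "u \<in> borel_measurable borel" for u
    by (rule Bochner_Integration.integrable_bound[OF b]) (use cb in auto)
  have "(\<lambda>k. LINT x|lborel. (cmod (cutoff R x (f x) - cutoff R x (g k x)))\<^sup>2)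
      \<longlonglongrightarrow> (LINT x|(lborel::real measure). 0)"
  proof (rule integral_dominated_convergence)
    show "integrable lborel (\<lambda>x. 4 * ?b x)" using b by (rule integrable_mult_right)
    show "AE x in lborel. (\<lambda>k. (cmod (cutoff R x (f x) - cutoff R x (g k x)))\<^sup>2) \<longlonglongrightarrow> 0"
      using AE
    proof eventually_elim
      case (elim x)
      have "(\<lambda>k. (cmod (cutoff R x (f x) - cutoff R x (g k x)))\<^sup>2)
          \<longlonglongrightarrow> (cmod (cutoff R x (f x) - cutoff R x (f x)))\<^sup>2"
        by (intro tendsto_intros tendsto_cutoff R lim elim)
      then show ?case by simp
    qed
    fix k
    have "(cmod (cutoff R x (f x) - cutoff R x (g k x)))\<^sup>2 \<le> 4 * ?b x" for x
      using cmod_diff_squared_bound[OF cutoff_bound[OF R] cutoff_bound[OF R], of x "f x" "g k x"]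
      by (simp add: power_mult_distrib split: split_indicator_asm split_indicator)
    then show "AE x in lborel. norm ((cmod (cutoff R x (f x) - cutoff R x (g k x)))\<^sup>2) \<le> 4 * ?b x"
      by simp
  qed auto
  then have "eventually (\<lambda>k. (LINT x|lborel. (cmod (cutoff R x (f x) - cutoff R x (g k x)))\<^sup>2) < e / 4) sequentially"
    using \<open>e > 0\<close> by (intro order_tendstoD(2)[where y=0]) simp_all
  then obtain k where k: "(LINT x|lborel. (cmod (cutoff R x (f x) - cutoff R x (g k x)))\<^sup>2) < e / 4"
    by (auto simp: eventually_sequentially)
  have i1: "integrable lborel (\<lambda>x. (cmod (f x - cutoff R x (f x)))\<^sup>2)"
    by (intro integrable_cmod_diff_squared int f2) auto
  have i2: "integrable lborel (\<lambda>x. (cmod (cutoff R x (f x) - cutoff R x (g k x)))\<^sup>2)"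
    by (intro integrable_cmod_diff_squared int) auto
  have "(LINT x|lborel. (cmod (f x - cutoff R x (g k x)))\<^sup>2)
      \<le> (LINT x|lborel. 2 * ((cmod (f x - cutoff R x (f x)))\<^sup>2 + (cmod (cutoff R x (f x) - cutoff R x (g k x)))\<^sup>2))"
  proof (rule integral_mono)
    show "integrable lborel (\<lambda>x. (cmod (f x - cutoff R x (g k x)))\<^sup>2)"
      by (intro integrable_cmod_diff_squared int f2) auto
    show "(cmod (f x - cutoff R x (g k x)))\<^sup>2
        \<le> 2 * ((cmod (f x - cutoff R x (f x)))\<^sup>2 + (cmod (cutoff R x (f x) - cutoff R x (g k x)))\<^sup>2)" for x
      using cmod_diff_squared_le[of "f x - cutoff R x (f x)" "cutoff R x (g k x) - cutoff R x (f x)"]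
      by (simp add: norm_minus_commute)
  qed (use i1 i2 in simp)
  also have "\<dots> < e"
    using i1 i2 n k by (simp add: R_def)
  finally show ?thesis
    using that[of "\<lambda>x. cutoff R x (g k x)" R] continuous_cutoff[OF R g] cutoff_bound[OF R] int R
    by auto
qed

section \<open>Translations\<close>

lemma integrable_translate:
  fixes f :: "real \<Rightarrow> 'a :: {banach, second_countable_topology}"
  assumes "integrable lborel f"
  shows "integrable lborel (\<lambda>x. f (x + t))"
  using lborel_integrable_real_affine[OF assms, of 1 t] by (simp add: add.commute)

lemma integral_translate:
  fixes f :: "real \<Rightarrow> 'a :: {banach, second_countable_topology}"
  shows "(LINT x|lborel. f (x + t)) = (LINT x|lborel. f x)"
  using lborel_integral_real_affine[of 1 f t] by (simp add: add.commute)

text \<open>For a continuous function of compact support this is dominated convergence. The general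
  case follows by density, because translating the approximation error does not change its
  norm.\<close>

lemma L2_translation_tendsto:
  fixes f :: "real \<Rightarrow> complex"
  assumes [measurable]: "f \<in> borel_measurable borel"
    and f2: "integrable lborel (\<lambda>x. (cmod (f x))\<^sup>2)" and t: "t \<longlonglongrightarrow> 0"
  shows "(\<lambda>k. LINT x|lborel. (cmod (f (x + t k) - f x))\<^sup>2) \<longlonglongrightarrow> 0"
proof (rule order_tendstoI)
  fix e :: real assume "e > 0"
  \<comment> \<open>The approximation errors will enter with total factor 8 and the shift of
    \<open>h\<close> with factor 2: \<open>8 * (e / 16) + 2 * (e / 4) = e\<close>.\<close>
  then have "e / 16 > 0" by simp
  from L2_dense_continuous_compact_support[OF assms(1) f2 this]
  obtain h R where h: "continuous_on UNIV h" and R: "R > 0"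
    and hb: "\<And>x. cmod (h x) \<le> R * indicator {-R..R} x"
    and h2: "integrable lborel (\<lambda>x. (cmod (h x))\<^sup>2)"
    and fh: "(LINT x|lborel. (cmod (f x - h x))\<^sup>2) < e / 16" by blast
  have [measurable]: "h \<in> borel_measurable borel"
    using h by (rule borel_measurable_continuous_onI)
  \<comment> \<open>One bound for all shifts puts the supports of all translates of \<open>h\<close>
    into the same interval, hence a majorant independent of \<open>k\<close>.\<close>
  obtain B where B: "\<And>k. \<bar>t k\<bar> \<le> B"
    using convergent_imp_bounded[OF t] unfolding bounded_iff by auto
  have B0: "B \<ge> 0" using B[of 0] by linarith
  have "(\<lambda>k. LINT x|lborel. (cmod (h (x + t k) - h x))\<^sup>2) \<longlonglongrightarrow> (LINT x|(lborel::real measure). 0)"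
  proof (rule integral_dominated_convergence)
    show "integrable lborel (\<lambda>x. 4 * R\<^sup>2 * indicator {-R-B..R+B} x :: real)"
      by (intro integrable_mult_right integrable_real_indicator) (auto simp: emeasure_lborel_Icc_eq)
    show "AE x in lborel. (\<lambda>k. (cmod (h (x + t k) - h x))\<^sup>2) \<longlonglongrightarrow> 0"
    proof (rule AE_I2)
      fix x
      have "isCont h x" using h by (simp add: continuous_on_eq_continuous_at)
      moreover have "(\<lambda>k. x + t k) \<longlonglongrightarrow> x" using tendsto_add[OF tendsto_const t, of x] by simp
      ultimately have "(\<lambda>k. h (x + t k)) \<longlonglongrightarrow> h x" by (rule isCont_tendsto_compose)
      then have "(\<lambda>k. (cmod (h (x + t k) - h x))\<^sup>2) \<longlonglongrightarrow> (cmod (h x - h x))\<^sup>2"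
        by (intro tendsto_intros)
      then show "(\<lambda>k. (cmod (h (x + t k) - h x))\<^sup>2) \<longlonglongrightarrow> 0" by simp
    qed
    fix k
    have "(cmod (h (x + t k) - h x))\<^sup>2 \<le> 4 * R\<^sup>2 * indicator {-R-B..R+B} x" for x
    proof (cases "x \<in> {-R-B..R+B}")
      case True
      have "cmod (h y) \<le> R" for y
        using hb[of y] R by (auto split: split_indicator_asm)
      then have "(cmod (h (x + t k) - h x))\<^sup>2 \<le> 4 * R\<^sup>2"
        by (intro cmod_diff_squared_bound)
      then show ?thesis using True by simp
    next
      case False
      have "x \<notin> {-R..R}" "x + t k \<notin> {-R..R}" using False B[of k] B0 by auto
      then have "h x = 0" "h (x + t k) = 0" using hb[of x] hb[of "x + t k"] by auto
      then show ?thesis by simp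
    qed
    then show "AE x in lborel. norm ((cmod (h (x + t k) - h x))\<^sup>2) \<le> 4 * R\<^sup>2 * indicator {-R-B..R+B} x"
      by simp
  qed auto
  then have "eventually (\<lambda>k. (LINT x|lborel. (cmod (h (x + t k) - h x))\<^sup>2) < e / 4) sequentially"
    using \<open>e > 0\<close> by (intro order_tendstoD(2)[where y=0]) simp_all
  then show "eventually (\<lambda>k. (LINT x|lborel. (cmod (f (x + t k) - f x))\<^sup>2) < e) sequentially"
  proof eventually_elim
    case (elim k)
    have ih: "integrable lborel (\<lambda>x. (cmod (h (x + t k) - h x))\<^sup>2)"
      using integrable_translate[OF h2] h2 by (intro integrable_cmod_diff_squared) auto
    have if0: "integrable lborel (\<lambda>x. (cmod (f x - h x))\<^sup>2)"
      using f2 h2 by (intro integrable_cmod_diff_squared) auto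
    have ift: "integrable lborel (\<lambda>x. (cmod (f (x + t k) - h (x + t k)))\<^sup>2)"
      using integrable_translate[OF if0] by simp
    have "(LINT x|lborel. (cmod (f (x + t k) - f x))\<^sup>2)
       \<le> (LINT x|lborel. 2 * (cmod (h (x + t k) - h x))\<^sup>2
            + 4 * ((cmod (f (x + t k) - h (x + t k)))\<^sup>2 + (cmod (f x - h x))\<^sup>2))"
    proof (rule integral_mono)
      show "integrable lborel (\<lambda>x. (cmod (f (x + t k) - f x))\<^sup>2)"
        using integrable_translate[OF f2] f2 by (intro integrable_cmod_diff_squared) auto
      show "(cmod (f (x + t k) - f x))\<^sup>2 \<le> 2 * (cmod (h (x + t k) - h x))\<^sup>2
            + 4 * ((cmod (f (x + t k) - h (x + t k)))\<^sup>2 + (cmod (f x - h x))\<^sup>2)" for x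
        \<comment> \<open>\<open>f (x + t k) - f x\<close> is the increment of \<open>h\<close>
          minus a difference of two approximation errors; splitting that difference in turn doubles
          its factor to 4.\<close>
        using cmod_diff_squared_le[of "h (x + t k) - h x" "(f x - h x) - (f (x + t k) - h (x + t k))"]
          cmod_diff_squared_le[of "f x - h x" "f (x + t k) - h (x + t k)"]
        by (simp add: algebra_simps)
    qed (use ih if0 ift in simp)
    also have "\<dots> = 2 * (LINT x|lborel. (cmod (h (x + t k) - h x))\<^sup>2) + 8 * (LINT x|lborel. (cmod (f x - h x))\<^sup>2)"
      using ih if0 ift integral_translate[of "\<lambda>x. (cmod (f x - h x))\<^sup>2" "t k"] by simp
    also have "\<dots> < e" using elim fh by simp
    finally show ?case .
  qed
next
  fix e :: real assume "e < 0"
  then show "eventually (\<lambda>k. e < (LINT x|lborel. (cmod (f (x + t k) - f x))\<^sup>2)) sequentially"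
    by (intro always_eventually allI less_le_trans[OF _ Bochner_Integration.integral_nonneg]) auto
qed

section \<open>Plancherel and Parseval on \<open>L\<^sub>1 \<inter> L\<^sub>2\<close>\<close>

text \<open>A dilation of the characteristic function of the standard normal distribution. The
  result is written as a normal density of standard deviation \<open>e\<close> to exhibit it as an
  approximate identity for small \<open>e\<close>.\<close>

lemma gaussian_fourier:
  assumes "e > 0"
  shows "(LINT x|lborel. complex_of_real (std_normal_density (e * x)) * iexp (x * s))
    = complex_of_real (sqrt (2 * pi) * normal_density 0 e s)"
proof -
  have "complex_of_real (exp (- ((s / e)\<^sup>2) / 2)) = char std_normal_distribution (s / e)"
    by (simp add: char_std_normal_distribution)
  also have "\<dots> = (LINT y|lborel. complex_of_real (std_normal_density y) * iexp (s / e * y))"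
    unfolding char_def by (subst integral_density) (auto simp: scaleR_conv_of_real)
  also have "\<dots> = e *\<^sub>R (LINT x|lborel. complex_of_real (std_normal_density (e * x)) * iexp (s / e * (e * x)))"
    using assms by (subst lborel_integral_real_affine[of e _ 0]) auto
  also have "\<dots> = complex_of_real e * (LINT x|lborel. complex_of_real (std_normal_density (e * x)) * iexp (x * s))"
    using assms by (simp add: scaleR_conv_of_real mult.commute)
  finally have *: "(LINT x|lborel. complex_of_real (std_normal_density (e * x)) * iexp (x * s))
      = complex_of_real (exp (- ((s / e)\<^sup>2) / 2) / e)"
    using assms by (simp add: field_simps)
  have "exp (- ((s / e)\<^sup>2) / 2) / e = sqrt (2 * pi) * normal_density 0 e s"
    using assms by (simp add: normal_density_def real_sqrt_mult field_simps power_divide)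
  with * show ?thesis by (simp only:)
qed

lemma integrable_bounded_mult:
  fixes u v :: "'a \<Rightarrow> complex"
  assumes "integrable M u" and [measurable]: "v \<in> borel_measurable M" and "\<And>x. cmod (v x) \<le> C"
  shows "integrable M (\<lambda>x. v x * u x)"
proof (rule Bochner_Integration.integrable_bound)
  show "integrable M (\<lambda>x. C * cmod (u x))" using assms(1) by simp
  show "(\<lambda>x. v x * u x) \<in> borel_measurable M" using borel_measurable_integrable[OF assms(1)] by measurable
  have "cmod (v x) * cmod (u x) \<le> C * cmod (u x)" for x
    by (intro mult_right_mono assms) auto
  then have "norm (v x * u x) \<le> norm (C * cmod (u x))" for x
    unfolding norm_mult[of "v x"] real_norm_def by (rule order_trans[OF _ abs_ge_self])
  then show "AE x in M. norm (v x * u x) \<le> norm (C * cmod (u x))" by (rule AE_I2)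
qed

text \<open>Fubini applies since the double integral of the modulus is at most \<open>C\<close>
  times the product of the two \<open>L\<^sub>1\<close> norms. With an exponential kernel this moves
  the Fourier transform from one factor to the other.\<close>

lemma integral_kernel_swap:
  fixes u v :: "real \<Rightarrow> complex" and k :: "real \<Rightarrow> real \<Rightarrow> complex"
  assumes u: "integrable lborel u" and v: "integrable lborel v"
    and k [measurable]: "case_prod k \<in> borel_measurable (borel \<Otimes>\<^sub>M borel)" and kb: "\<And>x y. cmod (k x y) \<le> C"
  shows "(LINT x|lborel. u x * (LINT y|lborel. k x y * v y))
    = (LINT y|lborel. v y * (LINT x|lborel. k x y * u x))"
proof -
  have [measurable]: "u \<in> borel_measurable borel" "v \<in> borel_measurable borel"
    using u v by auto
  have C: "C \<ge> 0" using kb[of 0 0] by (rule order_trans[OF norm_ge_zero])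
  have int: "integrable (lborel \<Otimes>\<^sub>M lborel) (\<lambda>(x, y). u x * (k x y * v y))"
  proof (rule lborel_pair.Fubini_integrable)
    show "integrable lborel (\<lambda>x. LINT y|lborel. norm (case (x, y) of (x, y) \<Rightarrow> u x * (k x y * v y)))"
    proof (rule Bochner_Integration.integrable_bound)
      show "integrable lborel (\<lambda>x. (C * (LINT y|lborel. cmod (v y))) * cmod (u x))"
        using u by simp
      have "(LINT y|lborel. cmod (u x * (k x y * v y))) \<le> (LINT y|lborel. C * cmod (u x) * cmod (v y))" for x
      proof (rule integral_mono)
        show "cmod (u x * (k x y * v y)) \<le> C * cmod (u x) * cmod (v y)" for y
          using mult_right_mono[OF kb[of x y], of "cmod (u x) * cmod (v y)"]
          by (simp add: norm_mult mult_ac)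
        show "integrable lborel (\<lambda>y. cmod (u x * (k x y * v y)))"
          by (intro integrable_norm integrable_mult_right integrable_bounded_mult[OF v _ kb]) measurable
      qed (use v in simp)
      also have "\<dots> x = (C * (LINT y|lborel. cmod (v y))) * cmod (u x)" for x by simp
      finally have le: "(LINT y|lborel. cmod (u x * (k x y * v y))) \<le> (C * (LINT y|lborel. cmod (v y))) * cmod (u x)" for x .
      have "norm (LINT y|lborel. cmod (u x * (k x y * v y))) \<le> norm ((C * (LINT y|lborel. cmod (v y))) * cmod (u x))" for x
        using le[of x] by (simp only: real_norm_def abs_of_nonneg[OF Bochner_Integration.integral_nonneg] norm_ge_zero
            order_trans[OF _ abs_ge_self])
      then show "AE x in lborel. norm (LINT y|lborel. norm (case (x, y) of (x, y) \<Rightarrow> u x * (k x y * v y)))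
          \<le> norm ((C * (LINT y|lborel. cmod (v y))) * cmod (u x))"
        unfolding case_prod_conv by (rule AE_I2)
    qed measurable
    have "integrable lborel (\<lambda>y. u x * (k x y * v y))" for x
      by (intro integrable_mult_right integrable_bounded_mult[OF v _ kb]) measurable
    then show "AE x in lborel. integrable lborel (\<lambda>y. case (x, y) of (x, y) \<Rightarrow> u x * (k x y * v y))"
      unfolding case_prod_conv by (rule AE_I2)
  qed measurable
  have "(LINT x|lborel. u x * (LINT y|lborel. k x y * v y)) = (LINT x|lborel. LINT y|lborel. u x * (k x y * v y))"
    by (simp only: integral_mult_right_zero)
  also have "\<dots> = (LINT y|lborel. LINT x|lborel. u x * (k x y * v y))"
    using lborel_pair.Fubini_integral[OF int] by simp
  also have "\<dots> = (LINT y|lborel. LINT x|lborel. v y * (k x y * u x))"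
    by (simp only: mult_ac)
  also have "\<dots> = (LINT y|lborel. v y * (LINT x|lborel. k x y * u x))"
    by (simp only: integral_mult_right_zero)
  finally show ?thesis .
qed

section \<open>The Fourier transform of integrable functions\<close>

text \<open>Positive exponent and no normalising constant; Plancherel's identity therefore carries
  the factor \<open>2 * pi\<close>, to be cancelled by the constants of
  \<open>fourier_family\<close>.\<close>

definition fourier :: "(real \<Rightarrow> complex) \<Rightarrow> real \<Rightarrow> complex" where
  "fourier f x = (LINT \<xi>|lborel. iexp (x * \<xi>) * f \<xi>)"

lemma borel_measurable_fourier [measurable]:
  assumes [measurable]: "f \<in> borel_measurable borel"
  shows "fourier f \<in> borel_measurable borel"
  unfolding fourier_def by measurable

lemma integrable_iexp_mult:
  assumes "integrable lborel f"
  shows "integrable lborel (\<lambda>\<xi>. iexp (x * \<xi>) * f \<xi>)"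
  by (rule integrable_bounded_mult[OF assms, where C=1]) auto

lemma fourier_bound:
  assumes "integrable lborel f"
  shows "cmod (fourier f x) \<le> (LINT \<xi>|lborel. cmod (f \<xi>))"
proof -
  have "cmod (fourier f x) \<le> (LINT \<xi>|lborel. cmod (iexp (x * \<xi>) * f \<xi>))"
    unfolding fourier_def by (rule integral_norm_bound)
  then show ?thesis by (simp add: norm_mult)
qed

lemma fourier_add_cmult:
  assumes "integrable lborel f" "integrable lborel h"
  shows "fourier (\<lambda>x. f x + c * h x) x = fourier f x + c * fourier h x"
proof -
  have "fourier (\<lambda>x. f x + c * h x) x
    = (LINT \<xi>|lborel. iexp (x * \<xi>) * f \<xi> + c * (iexp (x * \<xi>) * h \<xi>))"
    unfolding fourier_def by (intro Bochner_Integration.integral_cong) (auto simp: algebra_simps)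
  also have "\<dots> = fourier f x + c * fourier h x"
    unfolding fourier_def
    by (simp only: Bochner_Integration.integral_add integrable_iexp_mult integrable_mult_right assms
        integral_mult_right_zero)
  finally show ?thesis .
qed

lemma cnj_fourier: "cnj (fourier f x) = (LINT \<xi>|lborel. iexp (- (x * \<xi>)) * cnj (f \<xi>))"
  unfolding fourier_def Bochner_Integration.integral_cnj[symmetric]
  by (intro Bochner_Integration.integral_cong) (auto simp: exp_cnj)

lemma cmod_diff_squared: "(cmod (a - b))\<^sup>2 = (cmod a)\<^sup>2 + (cmod b)\<^sup>2 - 2 * Re (cnj b * a)"
  unfolding cmod_power2 by (simp add: power2_eq_square algebra_simps)

text \<open>The bound is uniform in \<open>t\<close>, so it provides majorants for Gaussian averages
  over the shift.\<close>

lemma integral_translation_diff_bound: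
  fixes f :: "real \<Rightarrow> complex"
  assumes [measurable]: "f \<in> borel_measurable borel" and f2: "integrable lborel (\<lambda>x. (cmod (f x))\<^sup>2)"
  shows "(LINT x|lborel. (cmod (f (x + t) - f x))\<^sup>2) \<le> 4 * (LINT x|lborel. (cmod (f x))\<^sup>2)"
proof -
  note f2t = integrable_translate[OF f2, of t]
  have "(LINT x|lborel. (cmod (f (x + t) - f x))\<^sup>2)
      \<le> (LINT x|lborel. 2 * ((cmod (f (x + t)))\<^sup>2 + (cmod (f x))\<^sup>2))"
    using f2 f2t by (intro integral_mono integrable_cmod_diff_squared cmod_diff_squared_le) auto
  also have "\<dots> = 4 * (LINT x|lborel. (cmod (f x))\<^sup>2)"
    using f2 f2t integral_translate[of "\<lambda>x. (cmod (f x))\<^sup>2" t] by simp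
  finally show ?thesis .
qed

section \<open>Gaussian regularisation and Plancherel's identity\<close>

text \<open>The weight makes every integral absolutely convergent before \<open>fourier f\<close> is
  known to be square integrable. Integrating out \<open>x\<close> first turns the weight into a
  normal density in the shift variable, and taking real parts leaves only norms of translation
  differences.\<close>

lemma gaussian_weighted_fourier_norm:
  fixes f :: "real \<Rightarrow> complex"
  assumes f1: "integrable lborel f" and f2: "integrable lborel (\<lambda>x. (cmod (f x))\<^sup>2)" and e: "e > 0"
  shows "(LINT x|lborel. std_normal_density (e * x) * (cmod (fourier f x))\<^sup>2)
    = sqrt (2 * pi) * ((LINT x|lborel. (cmod (f x))\<^sup>2)
        - (LINT s|lborel. std_normal_density s * (LINT x|lborel. (cmod (f (x + e * s) - f x))\<^sup>2)) / 2)"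
proof -
  have [measurable]: "f \<in> borel_measurable borel" using f1 by auto
  define S where "S = (LINT x|lborel. (cmod (f x))\<^sup>2)"
  define B where "B = (LINT x|lborel. cmod (f x))"
  \<comment> \<open>\<open>w\<close> measures the failure of translation invariance and
    \<open>A\<close> is the autocorrelation; \<open>ReA\<close> below links the two.\<close>
  define w where "w t = (LINT x|lborel. (cmod (f (x + t) - f x))\<^sup>2)" for t
  define A where "A t = (LINT x|lborel. cnj (f (x + t)) * f x)" for t
  have [measurable]: "w \<in> borel_measurable borel" "A \<in> borel_measurable borel"
    unfolding w_def A_def by measurable
  let ?\<phi> = "\<lambda>x. complex_of_real (std_normal_density (e * x))"
  have \<phi>: "integrable lborel ?\<phi>"
    using lborel_integrable_real_affine[of std_normal_density e 0] e by simp
  have bF: "cmod (cnj (fourier f x)) \<le> B" for x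
    using fourier_bound[OF f1] by (simp add: B_def)
  have f2t: "integrable lborel (\<lambda>x. (cmod (f (x + t)))\<^sup>2)" for t
    using integrable_translate[OF f2] .
  have inner: "(LINT x|lborel. iexp (x * \<xi>) * (cnj (fourier f x) * ?\<phi> x))
      = complex_of_real (sqrt (2 * pi)) * (LINT t|lborel. complex_of_real (normal_density 0 e t) * cnj (f (\<xi> + t)))" for \<xi>
  proof -
    have "(LINT x|lborel. iexp (x * \<xi>) * (cnj (fourier f x) * ?\<phi> x))
      = (LINT x|lborel. (iexp (x * \<xi>) * ?\<phi> x) * (LINT \<eta>|lborel. iexp (- (x * \<eta>)) * cnj (f \<eta>)))"
      by (simp only: cnj_fourier mult_ac)
    also have "\<dots> = (LINT \<eta>|lborel. cnj (f \<eta>) * (LINT x|lborel. iexp (- (x * \<eta>)) * (iexp (x * \<xi>) * ?\<phi> x)))"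
      by (rule integral_kernel_swap[where C=1])
         (use f1 in \<open>auto intro!: integrable_bounded_mult[OF \<phi>, where C=1]\<close>)
    also have "\<dots> = (LINT \<eta>|lborel. cnj (f \<eta>) * (LINT x|lborel. ?\<phi> x * iexp (x * (\<xi> - \<eta>))))"
    proof -
      have "iexp (- (x * \<eta>)) * (iexp (x * \<xi>) * ?\<phi> x) = ?\<phi> x * iexp (x * (\<xi> - \<eta>))" for x \<eta>
      proof -
        have "iexp (x * (\<xi> - \<eta>)) = iexp (- (x * \<eta>)) * iexp (x * \<xi>)"
          unfolding exp_add[symmetric] by (simp add: algebra_simps)
        then show ?thesis by (simp only: mult_ac)
      qed
      then show ?thesis by (simp only:)
    qed
    also have "\<dots> = (LINT \<eta>|lborel. cnj (f \<eta>) * complex_of_real (sqrt (2 * pi) * normal_density 0 e (\<xi> - \<eta>)))"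
      by (simp only: gaussian_fourier[OF e])
    \<comment> \<open>The shift \<open>\<eta> = t + \<xi>\<close> makes \<open>t\<close> the lag of
      the autocorrelation; the sign it produces disappears because the density is even.\<close>
    also have "\<dots> = (LINT t|lborel. cnj (f (t + \<xi>)) * complex_of_real (sqrt (2 * pi) * normal_density 0 e (\<xi> - (t + \<xi>))))"
      by (rule integral_translate[symmetric])
    also have "\<dots> = (LINT t|lborel. complex_of_real (sqrt (2 * pi)) * (complex_of_real (normal_density 0 e t) * cnj (f (\<xi> + t))))"
      by (intro Bochner_Integration.integral_cong) (auto simp: normal_density_def add.commute)
    finally show ?thesis by (simp only: integral_mult_right_zero)
  qed
  \<comment> \<open>The arithmetic-geometric mean inequality and translation invariance bound the
    inner integral uniformly in \<open>t\<close>, so the normal density alone ensures integrability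
    of the double integral.\<close>
  have Abound: "(LINT x|lborel. cmod (cnj (f (x + t)) * f x)) \<le> S" for t
  proof -
    have "(LINT x|lborel. cmod (cnj (f (x + t)) * f x)) \<le> (LINT x|lborel. ((cmod (f (x + t)))\<^sup>2 + (cmod (f x))\<^sup>2) / 2)"
    proof (rule integral_mono)
      show "integrable lborel (\<lambda>x. cmod (cnj (f (x + t)) * f x))"
        by (intro integrable_norm integrable_cnj_mult f2 f2t) auto
      show "cmod (cnj (f (x + t)) * f x) \<le> ((cmod (f (x + t)))\<^sup>2 + (cmod (f x))\<^sup>2) / 2" for x
        using sum_squares_bound[of "cmod (f (x + t))" "cmod (f x)"] by (simp add: norm_mult)
    qed (use f2 f2t in simp)
    also have "\<dots> = S"
      using f2 f2t integral_translate[of "\<lambda>x. (cmod (f x))\<^sup>2" t] by (simp add: S_def)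
    finally show ?thesis .
  qed
  have intT: "integrable (lborel \<Otimes>\<^sub>M lborel) (\<lambda>(t, \<xi>). complex_of_real (normal_density 0 e t) * (cnj (f (\<xi> + t)) * f \<xi>))"
  proof (rule lborel_pair.Fubini_integrable)
    show "integrable lborel (\<lambda>t. LINT \<xi>|lborel. norm (case (t, \<xi>) of (t, \<xi>) \<Rightarrow> complex_of_real (normal_density 0 e t) * (cnj (f (\<xi> + t)) * f \<xi>)))"
    proof (rule Bochner_Integration.integrable_bound)
      show "integrable lborel (\<lambda>t. normal_density 0 e t * S)" using e by simp
      have "normal_density 0 e t * (LINT x|lborel. cmod (cnj (f (x + t)) * f x)) \<le> normal_density 0 e t * S" for t
        using Abound by (rule mult_left_mono) auto
      then show "AE t in lborel. norm (LINT \<xi>|lborel. norm (case (t, \<xi>) of (t, \<xi>) \<Rightarrow> complex_of_real (normal_density 0 e t) * (cnj (f (\<xi> + t)) * f \<xi>)))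
          \<le> norm (normal_density 0 e t * S)"
        by (auto intro!: AE_I2 simp: norm_mult abs_mult abs_of_nonneg Bochner_Integration.integral_nonneg S_def)
    qed measurable
    show "AE t in lborel. integrable lborel (\<lambda>\<xi>. case (t, \<xi>) of (t, \<xi>) \<Rightarrow> complex_of_real (normal_density 0 e t) * (cnj (f (\<xi> + t)) * f \<xi>))"
      by (auto intro!: AE_I2 integrable_mult_right integrable_cnj_mult f2 f2t)
  qed measurable
  \<comment> \<open>The squared modulus is split as \<open>cnj (fourier f x) * fourier f x\<close>;
    only the second factor is expanded, and then \<open>inner\<close> evaluates the
    \<open>x\<close>-integral.\<close>
  have "complex_of_real (LINT x|lborel. std_normal_density (e * x) * (cmod (fourier f x))\<^sup>2)
    = (LINT x|lborel. (cnj (fourier f x) * ?\<phi> x) * (LINT \<xi>|lborel. iexp (x * \<xi>) * f \<xi>))"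
    unfolding fourier_def[symmetric] integral_complex_of_real[symmetric]
    by (intro Bochner_Integration.integral_cong) (auto simp: complex_norm_square mult_ac simp del: of_real_power)
  also have "\<dots> = (LINT \<xi>|lborel. f \<xi> * (LINT x|lborel. iexp (x * \<xi>) * (cnj (fourier f x) * ?\<phi> x)))"
    by (rule integral_kernel_swap[where C=1])
       (auto intro!: integrable_bounded_mult[OF \<phi>, where C=B] f1 bF)
  also have "\<dots> = (LINT \<xi>|lborel. complex_of_real (sqrt (2 * pi)) *
      (LINT t|lborel. complex_of_real (normal_density 0 e t) * (cnj (f (\<xi> + t)) * f \<xi>)))"
  proof -
    have "(LINT t|lborel. complex_of_real (normal_density 0 e t) * (cnj (f (\<xi> + t)) * f \<xi>))
        = (LINT t|lborel. complex_of_real (normal_density 0 e t) * cnj (f (\<xi> + t))) * f \<xi>" for \<xi>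
      by (simp only: integral_mult_left_zero flip: mult.assoc)
    then show ?thesis unfolding inner by (simp only: mult_ac)
  qed
  also have "\<dots> = complex_of_real (sqrt (2 * pi)) * (LINT t|lborel. LINT \<xi>|lborel. complex_of_real (normal_density 0 e t) * (cnj (f (\<xi> + t)) * f \<xi>))"
    using lborel_pair.Fubini_integral[OF intT] by (simp only: integral_mult_right_zero case_prod_conv)
  also have "\<dots> = complex_of_real (sqrt (2 * pi)) * (LINT t|lborel. complex_of_real (normal_density 0 e t) * A t)"
    by (simp only: integral_mult_right_zero A_def)
  finally have 1: "complex_of_real (LINT x|lborel. std_normal_density (e * x) * (cmod (fourier f x))\<^sup>2)
    = complex_of_real (sqrt (2 * pi)) * (LINT t|lborel. complex_of_real (normal_density 0 e t) * A t)" .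
  have intA: "integrable lborel (\<lambda>t. complex_of_real (normal_density 0 e t) * A t)"
    using lborel_pair.integrable_fst'[OF intT] by (simp add: A_def)
  have ReA: "Re (A t) = S - w t / 2" for t
  proof -
    have i: "integrable lborel (\<lambda>x. cnj (f (x + t)) * f x)"
      by (intro integrable_cnj_mult f2 f2t) auto
    have "w t = (LINT x|lborel. (cmod (f x - f (x + t)))\<^sup>2)"
      unfolding w_def by (simp add: norm_minus_commute)
    also have "\<dots> = 2 * S - 2 * Re (A t)"
      unfolding cmod_diff_squared A_def S_def
      using i f2 f2t integral_translate[of "\<lambda>x. (cmod (f x))\<^sup>2" t]
      by (simp del: times_complex.sel)
    finally show ?thesis by (simp add: field_simps)
  qed
  have "(LINT x|lborel. std_normal_density (e * x) * (cmod (fourier f x))\<^sup>2)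
    = sqrt (2 * pi) * Re (LINT t|lborel. complex_of_real (normal_density 0 e t) * A t)"
    using arg_cong[OF 1, of Re] by simp
  also have "Re (LINT t|lborel. complex_of_real (normal_density 0 e t) * A t) = (LINT t|lborel. normal_density 0 e t * (S - w t / 2))"
    using intA by (simp add: ReA flip: integral_Re)
  \<comment> \<open>The substitution \<open>t = e * s\<close> gives a weight independent of
    \<open>e\<close>, which then survives only in the shift.\<close>
  also have "\<dots> = e * (LINT s|lborel. normal_density 0 e (e * s) * (S - w (e * s) / 2))"
    using lborel_integral_real_affine[of e "\<lambda>t. normal_density 0 e t * (S - w t / 2)" 0] e by simp
  also have "\<dots> = (LINT s|lborel. (e * normal_density 0 e (e * s)) * (S - w (e * s) / 2))"
    by (simp add: mult.assoc)
  also have "(\<lambda>s. e * normal_density 0 e (e * s)) = std_normal_density"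
    using e by (auto simp: normal_density_def real_sqrt_mult field_simps power_mult_distrib)
  also have "(LINT s|lborel. std_normal_density s * (S - w (e * s) / 2))
      = (LINT s|lborel. S * std_normal_density s - std_normal_density s * w (e * s) / 2)"
    by (simp add: algebra_simps)
  also have "\<dots> = S - (LINT s|lborel. std_normal_density s * w (e * s)) / 2"
  proof -
    have w: "0 \<le> w t" "w t \<le> 4 * S" for t
      using integral_translation_diff_bound[OF _ f2] by (auto simp: w_def S_def)
    have "integrable lborel (\<lambda>s. std_normal_density s * w (e * s))"
    proof (rule Bochner_Integration.integrable_bound)
      show "integrable lborel (\<lambda>s. std_normal_density s * (4 * S))" by simp
      show "AE s in lborel. norm (std_normal_density s * w (e * s)) \<le> norm (std_normal_density s * (4 * S))"
        using w by (auto intro!: AE_I2 mult_left_mono simp: abs_mult abs_of_nonneg S_def)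
    qed measurable
    then show ?thesis by simp
  qed
  finally show ?thesis by (simp add: S_def w_def)
qed

text \<open>As \<open>e\<close> decreases to 0, the Gaussian weights increase to the constant
  \<open>1 / sqrt (2 * pi)\<close>, so monotone convergence yields integrability and value together.
  The regularised integrals converge because the averaged translation differences tend to 0.\<close>

lemma
  fixes f :: "real \<Rightarrow> complex"
  assumes f1: "integrable lborel f" and f2: "integrable lborel (\<lambda>x. (cmod (f x))\<^sup>2)"
  shows integrable_fourier_squared: "integrable lborel (\<lambda>x. (cmod (fourier f x))\<^sup>2)" (is ?I)
    and plancherel: "(LINT x|lborel. (cmod (fourier f x))\<^sup>2) = 2 * pi * (LINT x|lborel. (cmod (f x))\<^sup>2)" (is ?P)
proof -
  have [measurable]: "f \<in> borel_measurable borel" using f1 by auto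
  define S where "S = (LINT x|lborel. (cmod (f x))\<^sup>2)"
  define B where "B = (LINT x|lborel. cmod (f x))"
  define w where "w t = (LINT x|lborel. (cmod (f (x + t) - f x))\<^sup>2)" for t
  define e where "e k = 1 / real (Suc k)" for k
  have [measurable]: "w \<in> borel_measurable borel"
    unfolding w_def by measurable
  have e: "e k > 0" for k by (simp add: e_def)
  have e0: "e \<longlonglongrightarrow> 0" unfolding e_def by real_asymp
  have e_mono: "e j \<le> e i" if "i \<le> j" for i j using that by (simp add: e_def field_simps)
  have w: "0 \<le> w t" "w t \<le> 4 * S" for t
    using integral_translation_diff_bound[OF _ f2] by (auto simp: w_def S_def)
  let ?F = "\<lambda>k x. std_normal_density (e k * x) * (cmod (fourier f x))\<^sup>2"
  let ?u = "\<lambda>x. (cmod (fourier f x))\<^sup>2 / sqrt (2 * pi)"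
  \<comment> \<open>At a fixed level the transform is just bounded by the \<open>L\<^sub>1\<close>
    norm of \<open>f\<close>, and the Gaussian is integrable.\<close>
  have int: "integrable lborel (?F k)" for k
  proof (rule Bochner_Integration.integrable_bound)
    show "integrable lborel (\<lambda>x. std_normal_density (e k * x) * B\<^sup>2)"
      using lborel_integrable_real_affine[of std_normal_density "e k" 0] e[of k] by simp
    have "(cmod (fourier f x))\<^sup>2 \<le> B\<^sup>2" for x
      using fourier_bound[OF f1] unfolding B_def by (intro power_mono) auto
    then have "?F k x \<le> std_normal_density (e k * x) * B\<^sup>2" for x
      by (intro mult_left_mono) auto
    then show "AE x in lborel. norm (?F k x) \<le> norm (std_normal_density (e k * x) * B\<^sup>2)"
      by (intro AE_I2) (simp add: abs_mult)
  qed measurable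
  have "(\<lambda>k. LINT s|lborel. std_normal_density s * w (e k * s)) \<longlonglongrightarrow> (LINT s|(lborel::real measure). 0)"
  proof (rule integral_dominated_convergence)
    show "integrable lborel (\<lambda>s. std_normal_density s * (4 * S))" by simp
    have "(\<lambda>k. std_normal_density s * w (e k * s)) \<longlonglongrightarrow> std_normal_density s * 0" for s
      unfolding w_def using tendsto_mult_left_zero[OF e0]
      by (intro tendsto_mult tendsto_const L2_translation_tendsto f2) auto
    then show "AE s in lborel. (\<lambda>k. std_normal_density s * w (e k * s)) \<longlonglongrightarrow> 0" by simp
    show "AE s in lborel. norm (std_normal_density s * w (e k * s)) \<le> std_normal_density s * (4 * S)" for k
      using w by (auto intro!: AE_I2 mult_left_mono simp: abs_mult abs_of_nonneg)
  qed measurable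
  then have "(\<lambda>k. sqrt (2 * pi) * (S - (LINT s|lborel. std_normal_density s * w (e k * s)) / 2))
      \<longlonglongrightarrow> sqrt (2 * pi) * (S - 0 / 2)"
    by (intro tendsto_intros) simp_all
  then have lim: "(\<lambda>k. LINT x|lborel. ?F k x) \<longlonglongrightarrow> sqrt (2 * pi) * S"
    using gaussian_weighted_fourier_norm[OF f1 f2 e] by (simp add: S_def w_def)
  have "has_bochner_integral lborel ?u (sqrt (2 * pi) * S)"
  proof (rule has_bochner_integral_monotone_convergence[OF int])
    have "std_normal_density (e i * x) \<le> std_normal_density (e j * x)" if "i \<le> j" for i j x
    proof -
      have "(e j * x)\<^sup>2 \<le> (e i * x)\<^sup>2"
        unfolding power_mult_distrib using e_mono[OF that] e[of j]
        by (intro mult_right_mono power_mono) auto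
      then show ?thesis by (simp add: std_normal_density_def divide_right_mono)
    qed
    then show "AE x in lborel. mono (\<lambda>k. ?F k x)"
      by (intro AE_I2 monoI mult_right_mono) auto
    have "(\<lambda>k. ?F k x) \<longlonglongrightarrow> 1 / sqrt (2 * pi) * exp (- (0 * x)\<^sup>2 / 2) * (cmod (fourier f x))\<^sup>2" for x
      unfolding std_normal_density_def by (intro tendsto_intros e0) auto
    then show "AE x in lborel. (\<lambda>k. ?F k x) \<longlonglongrightarrow> ?u x" by simp
    show "(\<lambda>k. LINT x|lborel. ?F k x) \<longlonglongrightarrow> sqrt (2 * pi) * S" by (rule lim)
  qed measurable
  then have "has_bochner_integral lborel (\<lambda>x. sqrt (2 * pi) * ?u x) (sqrt (2 * pi) * (sqrt (2 * pi) * S))"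
    by (intro has_bochner_integral_mult_right)
  then have "has_bochner_integral lborel (\<lambda>x. (cmod (fourier f x))\<^sup>2) (2 * pi * S)"
    by (simp flip: mult.assoc)
  then show ?I ?P
    by (simp_all add: has_bochner_integral_iff S_def)
qed

section \<open>From Plancherel's identity to Parseval's identity\<close>

text \<open>The cross term of \<open>Q c\<close> is twice the real part of \<open>c\<close> times
  the inner product: the real pair of \<open>c\<close> gives its real part, the imaginary pair its
  imaginary part. The signs fit conjugate linearity in the first argument.\<close>

lemma polarization:
  fixes f h :: "'a \<Rightarrow> complex"
  assumes [measurable]: "f \<in> borel_measurable M" "h \<in> borel_measurable M"
    and f: "integrable M (\<lambda>x. (cmod (f x))\<^sup>2)" and h: "integrable M (\<lambda>x. (cmod (h x))\<^sup>2)"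
  defines "Q \<equiv> \<lambda>c. complex_of_real (LINT x|M. (cmod (f x + c * h x))\<^sup>2)"
  shows "4 * (LINT x|M. cnj (f x) * h x) = Q 1 - Q (- 1) - \<i> * Q \<i> + \<i> * Q (- \<i>)"
proof -
  have int: "integrable M (\<lambda>x. complex_of_real ((cmod (f x + c * h x))\<^sup>2))" for c
  proof -
    have "integrable M (\<lambda>x. (cmod (f x - (- c) * h x))\<^sup>2)"
      by (rule integrable_cmod_diff_squared) (use f h in \<open>auto simp: norm_mult power_mult_distrib\<close>)
    then show ?thesis by (intro integrable_of_real) simp
  qed
  let ?q = "\<lambda>c x. complex_of_real ((cmod (f x + c * h x))\<^sup>2)"
  have eq: "4 * (cnj (f x) * h x) = ?q 1 x - ?q (- 1) x - \<i> * ?q \<i> x + \<i> * ?q (- \<i>) x" for x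
    unfolding cmod_power2 by (simp add: complex_eq_iff power2_eq_square algebra_simps)
  have "4 * (LINT x|M. cnj (f x) * h x) = (LINT x|M. 4 * (cnj (f x) * h x))"
    by (simp only: integral_mult_right_zero)
  also have "\<dots> = (LINT x|M. ?q 1 x) - (LINT x|M. ?q (- 1) x) - \<i> * (LINT x|M. ?q \<i> x) + \<i> * (LINT x|M. ?q (- \<i>) x)"
    unfolding eq by (simp only: Bochner_Integration.integral_add Bochner_Integration.integral_diff
        Bochner_Integration.integrable_add Bochner_Integration.integrable_diff integrable_mult_right int
        integral_mult_right_zero)
  also have "\<dots> = Q 1 - Q (- 1) - \<i> * Q \<i> + \<i> * Q (- \<i>)"
    by (simp only: Q_def integral_complex_of_real)
  finally show ?thesis .
qed

text \<open>By linearity of the transform, Plancherel's identity holds for each combination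
  \<open>f + c * h\<close>, and polarization on both sides transfers it to inner products.\<close>

lemma parseval:
  fixes f h :: "real \<Rightarrow> complex"
  assumes f1: "integrable lborel f" and f2: "integrable lborel (\<lambda>x. (cmod (f x))\<^sup>2)"
    and h1: "integrable lborel h" and h2: "integrable lborel (\<lambda>x. (cmod (h x))\<^sup>2)"
  shows "(LINT x|lborel. cnj (fourier f x) * fourier h x) = 2 * pi * (LINT x|lborel. cnj (f x) * h x)"
proof -
  have [measurable]: "f \<in> borel_measurable borel" "h \<in> borel_measurable borel" using f1 h1 by auto
  have *: "complex_of_real (LINT x|lborel. (cmod (fourier f x + c * fourier h x))\<^sup>2)
      = 2 * pi * complex_of_real (LINT x|lborel. (cmod (f x + c * h x))\<^sup>2)" for c
  proof -
    have 1: "integrable lborel (\<lambda>x. f x + c * h x)" using f1 h1 by simp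
    have "integrable lborel (\<lambda>x. (cmod (f x - (- c) * h x))\<^sup>2)"
      by (rule integrable_cmod_diff_squared) (use f2 h2 in \<open>auto simp: norm_mult power_mult_distrib\<close>)
    then have 2: "integrable lborel (\<lambda>x. (cmod (f x + c * h x))\<^sup>2)" by simp
    show ?thesis
      using plancherel[OF 1 2] unfolding fourier_add_cmult[OF f1 h1] by simp
  qed
  have "4 * (LINT x|lborel. cnj (f x) * h x) =
      (let Q = \<lambda>c. complex_of_real (LINT x|lborel. (cmod (f x + c * h x))\<^sup>2)
       in Q 1 - Q (- 1) - \<i> * Q \<i> + \<i> * Q (- \<i>))"
    unfolding Let_def by (rule polarization) (auto intro: f2 h2)
  moreover have "4 * (LINT x|lborel. cnj (fourier f x) * fourier h x) =
      (let Q = \<lambda>c. complex_of_real (LINT x|lborel. (cmod (fourier f x + c * fourier h x))\<^sup>2)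
       in Q 1 - Q (- 1) - \<i> * Q \<i> + \<i> * Q (- \<i>))"
    unfolding Let_def by (rule polarization) (auto intro: integrable_fourier_squared f1 f2 h1 h2)
  ultimately have "4 * (LINT x|lborel. cnj (fourier f x) * fourier h x) = 2 * pi * (4 * (LINT x|lborel. cnj (f x) * h x))"
    unfolding Let_def * by (simp only:) (simp only: algebra_simps)
  then show ?thesis by simp
qed

section \<open>Polynomial multiples of a rapidly decaying function\<close>

text \<open>The half-line case is reflected at the origin; the single point 0, missed by both
  halves, is a null set.\<close>

lemma integrable_inverse_1_plus_square: "integrable lborel (\<lambda>x::real. 1 / (1 + x\<^sup>2))"
proof -
  let ?h = "\<lambda>x::real. indicator {0<..} x *\<^sub>R (1 / (1 + x\<^sup>2))"
  have h: "integrable lborel ?h"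
    using integrable_I0i_1_div_plus_square
    by (simp add: interval_lebesgue_integrable_def set_integrable_def zero_ereal_def)
  have "integrable lborel (\<lambda>x. ?h x + ?h (0 + (- 1) * x))"
    by (intro Bochner_Integration.integrable_add h lborel_integrable_real_affine) auto
  moreover have "AE x in lborel. 1 / (1 + x\<^sup>2) = ?h x + ?h (0 + (- 1) * x)"
    using AE_lborel_singleton[of "0::real"] by eventually_elim (auto split: split_indicator)
  ultimately show ?thesis
    by (subst integrable_cong_AE) auto
qed

text \<open>On a bounded interval the power is bounded and \<open>g\<close> is square integrable;
  outside, decay yields a multiple of \<open>1 / (1 + \<xi>\<^sup>2)\<close>.\<close>

lemma integrable_power_mult_squared:
  assumes g: "g \<in> L2_space"
    and decay: "\<And>n::nat. ((\<lambda>\<xi>. cmod (complex_of_real (\<xi> ^ n) * g \<xi>)) \<longlongrightarrow> 0) at_infinity"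
  shows "integrable lebesgue (\<lambda>\<xi>. (cmod (complex_of_real (\<xi> ^ n) * g \<xi>))\<^sup>2)"
proof -
  have g_meas: "g \<in> borel_measurable lebesgue" and g2: "integrable lebesgue (\<lambda>x. (cmod (g x))\<^sup>2)"
    using g by (auto simp: L2_space_def)
  \<comment> \<open>One power more than \<open>n\<close>: after squaring, the extra factor is what
    gives quadratic decay.\<close>
  have "eventually (\<lambda>\<xi>. cmod (complex_of_real (\<xi> ^ Suc n) * g \<xi>) < 1) at_infinity"
    using decay by (rule order_tendstoD) simp
  then obtain b where b: "\<And>\<xi>. \<bar>\<xi>\<bar> \<ge> b \<Longrightarrow> cmod (complex_of_real (\<xi> ^ Suc n) * g \<xi>) < 1"
    by (auto simp: eventually_at_infinity)
  define B where "B = max 1 b"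
  have bound: "(cmod (complex_of_real (\<xi> ^ n) * g \<xi>))\<^sup>2 \<le> (B ^ n)\<^sup>2 * (cmod (g \<xi>))\<^sup>2 + 2 * (1 / (1 + \<xi>\<^sup>2))" for \<xi>
  proof (cases "\<bar>\<xi>\<bar> \<le> B")
    case True
    then have "(\<bar>\<xi>\<bar> ^ n * cmod (g \<xi>))\<^sup>2 \<le> (B ^ n * cmod (g \<xi>))\<^sup>2"
      by (intro power_mono mult_right_mono) auto
    moreover have "0 \<le> 2 * (1 / (1 + \<xi>\<^sup>2))" by simp
    ultimately have "(\<bar>\<xi>\<bar> ^ n * cmod (g \<xi>))\<^sup>2 \<le> (B ^ n * cmod (g \<xi>))\<^sup>2 + 2 * (1 / (1 + \<xi>\<^sup>2))"
      by linarith
    then show ?thesis by (simp add: norm_mult norm_power power_mult_distrib)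
  next
    case False
    then have \<xi>: "\<bar>\<xi>\<bar> \<ge> 1" "\<bar>\<xi>\<bar> \<ge> b" by (auto simp: B_def)
    let ?a = "cmod (complex_of_real (\<xi> ^ n) * g \<xi>)"
    have "\<bar>\<xi>\<bar> * ?a \<le> 1" using b[OF \<xi>(2)] by (simp add: norm_mult norm_power mult_ac)
    then have "(\<bar>\<xi>\<bar> * ?a)\<^sup>2 \<le> 1\<^sup>2" by (intro power_mono) auto
    then have *: "\<xi>\<^sup>2 * ?a\<^sup>2 \<le> 1" by (simp add: power_mult_distrib)
    have "1 \<le> \<xi>\<^sup>2" using \<xi>(1) by (simp add: abs_le_square_iff[of 1, simplified])
    then have "1 * ?a\<^sup>2 \<le> \<xi>\<^sup>2 * ?a\<^sup>2" by (intro mult_right_mono) auto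
    with * have "(1 + \<xi>\<^sup>2) * ?a\<^sup>2 \<le> 2" unfolding distrib_right by linarith
    then have "?a\<^sup>2 \<le> 2 * (1 / (1 + \<xi>\<^sup>2))"
      by (simp add: pos_le_divide_eq add_pos_nonneg mult.commute)
    moreover have "0 \<le> (B ^ n)\<^sup>2 * (cmod (g \<xi>))\<^sup>2" by simp
    ultimately show ?thesis by linarith
  qed
  show ?thesis
  proof (rule Bochner_Integration.integrable_bound)
    have "integrable lebesgue (\<lambda>\<xi>::real. 1 / (1 + \<xi>\<^sup>2))"
      using integrable_inverse_1_plus_square by (subst integrable_completion) auto
    then show "integrable lebesgue (\<lambda>\<xi>. (B ^ n)\<^sup>2 * (cmod (g \<xi>))\<^sup>2 + 2 * (1 / (1 + \<xi>\<^sup>2)))"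
      using g2 by (intro Bochner_Integration.integrable_add integrable_mult_right) auto
    show "AE \<xi> in lebesgue. norm ((cmod (complex_of_real (\<xi> ^ n) * g \<xi>))\<^sup>2)
        \<le> norm ((B ^ n)\<^sup>2 * (cmod (g \<xi>))\<^sup>2 + 2 * (1 / (1 + \<xi>\<^sup>2)))"
      using bound by (intro AE_I2) (simp add: order_trans[OF _ abs_ge_self])
    have "(\<lambda>\<xi>. complex_of_real (\<xi> ^ n)) \<in> borel_measurable lebesgue"
      by (rule measurable_completion) measurable
    then show "(\<lambda>\<xi>. (cmod (complex_of_real (\<xi> ^ n) * g \<xi>))\<^sup>2) \<in> borel_measurable lebesgue"
      by (intro borel_measurable_power measurable_compose[OF _ borel_measurable_norm] borel_measurable_times g_meas)
  qed
qed

lemma borel_measurable_poly [measurable]: "poly (q :: real poly) \<in> borel_measurable borel"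
  by (intro borel_measurable_continuous_onI continuous_intros)

lemma integrable_poly_mult_squared:
  fixes g :: "real \<Rightarrow> complex" and q :: "real poly"
  assumes [measurable]: "g \<in> borel_measurable borel"
    and g: "\<And>n::nat. integrable lborel (\<lambda>\<xi>. (cmod (complex_of_real (\<xi> ^ n) * g \<xi>))\<^sup>2)"
  shows "integrable lborel (\<lambda>\<xi>. (cmod (complex_of_real (poly q \<xi>) * g \<xi>))\<^sup>2)"
proof -
  \<comment> \<open>The extra monomial is needed for the induction: \<open>pCons a q\<close> leads
    to \<open>q\<close> multiplied by one more power of \<open>\<xi>\<close>.\<close>
  have "integrable lborel (\<lambda>\<xi>. (cmod (complex_of_real (\<xi> ^ n * poly q \<xi>) * g \<xi>))\<^sup>2)" for n
  proof (induction q arbitrary: n)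
    case 0
    then show ?case by simp
  next
    case (pCons a q)
    have "integrable lborel (\<lambda>\<xi>. (cmod (- complex_of_real a * (complex_of_real (\<xi> ^ n) * g \<xi>)))\<^sup>2)"
      unfolding norm_mult[of "- complex_of_real a"] power_mult_distrib by (intro integrable_mult_right g)
    then have "integrable lborel (\<lambda>\<xi>. (cmod (complex_of_real (\<xi> ^ Suc n * poly q \<xi>) * g \<xi>
        - (- complex_of_real a * (complex_of_real (\<xi> ^ n) * g \<xi>))))\<^sup>2)"
      by (intro integrable_cmod_diff_squared pCons) measurable
    then show ?case by (simp add: algebra_simps)
  qed
  from this[of 0] show ?thesis by simp
qed

text \<open>With the weight \<open>1 + \<xi>\<^sup>2\<close>, the arithmetic-geometric mean
  inequality bounds the modulus by \<open>1 / (1 + \<xi>\<^sup>2)\<close> plus the squares belonging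
  to \<open>q\<close> and to \<open>[:0, 1:] * q\<close>, that is, \<open>\<xi>\<close> times
  \<open>q\<close>.\<close>

lemma integrable_poly_mult:
  fixes g :: "real \<Rightarrow> complex" and q :: "real poly"
  assumes [measurable]: "g \<in> borel_measurable borel"
    and g: "\<And>n::nat. integrable lborel (\<lambda>\<xi>. (cmod (complex_of_real (\<xi> ^ n) * g \<xi>))\<^sup>2)"
  shows "integrable lborel (\<lambda>\<xi>. complex_of_real (poly q \<xi>) * g \<xi>)"
proof (rule Bochner_Integration.integrable_bound)
  let ?h = "\<lambda>q \<xi>. complex_of_real (poly q \<xi>) * g \<xi>"
  let ?b = "\<lambda>\<xi>. 1 / (1 + \<xi>\<^sup>2) + ((cmod (?h q \<xi>))\<^sup>2 + (cmod (?h ([:0, 1:] * q) \<xi>))\<^sup>2)"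
  show "integrable lborel ?b"
    by (intro Bochner_Integration.integrable_add integrable_inverse_1_plus_square
        integrable_poly_mult_squared g) auto
  have "cmod (?h q \<xi>) \<le> ?b \<xi>" for \<xi>
  proof -
    let ?a = "cmod (?h q \<xi>)"
    have pos: "1 + \<xi>\<^sup>2 > 0" by (simp add: add_pos_nonneg)
    have "2 * (1 / sqrt (1 + \<xi>\<^sup>2)) * (sqrt (1 + \<xi>\<^sup>2) * ?a) \<le> (1 / sqrt (1 + \<xi>\<^sup>2))\<^sup>2 + (sqrt (1 + \<xi>\<^sup>2) * ?a)\<^sup>2"
      by (rule sum_squares_bound)
    then have "2 * ?a \<le> 1 / (1 + \<xi>\<^sup>2) + (1 + \<xi>\<^sup>2) * ?a\<^sup>2"
      using pos by (simp add: power_mult_distrib power_divide)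
    moreover have "(cmod (?h ([:0, 1:] * q) \<xi>))\<^sup>2 = \<xi>\<^sup>2 * ?a\<^sup>2"
      by (simp add: norm_mult power_mult_distrib)
    moreover have "0 \<le> ?a" by simp
    ultimately show ?thesis unfolding distrib_right by linarith
  qed
  then show "AE \<xi> in lborel. norm (?h q \<xi>) \<le> norm (?b \<xi>)"
    unfolding real_norm_def by (intro AE_I2 order_trans[OF _ abs_ge_self])
qed measurable

section \<open>Polynomials of every degree span\<close>

text \<open>Induction on the degree: a multiple of the \<open>p n\<close> of equal degree cancels
  the leading term. A constant \<open>q\<close> leaves remainder 0, where
  \<open>smult[of 0 0]\<close> gives \<open>L 0 = 0\<close>.\<close>

lemma linear_functional_eq_0:
  fixes L :: "real poly \<Rightarrow> real"
  assumes add: "\<And>a b. L (a + b) = L a + L b" and smult: "\<And>c a. L (smult c a) = c * L a"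
    and deg: "\<And>n. degree (p n) = n" and nz: "\<And>n. p n \<noteq> 0" and 0: "\<And>n. L (p n) = 0"
  shows "L q = 0"
proof (induction "degree q" arbitrary: q rule: less_induct)
  case less
  define c where "c = lead_coeff q / lead_coeff (p (degree q))"
  define r where "r = q - smult c (p (degree q))"
  have "coeff r (degree q) = 0"
    using nz[of "degree q"] deg[of "degree q"] by (simp add: r_def c_def leading_coeff_0_iff[symmetric] del: leading_coeff_0_iff)
  moreover have "degree r \<le> degree q"
    unfolding r_def by (intro degree_diff_le) (auto simp: deg intro: order_trans[OF degree_smult_le])
  ultimately have "r = 0 \<or> degree r < degree q"
    by (intro eq_zero_or_degree_less)
  then have "L r = 0" using less smult[of 0 0] by auto
  moreover have "L q = L r + c * L (p (degree q))"
    unfolding smult[symmetric] add[symmetric] by (simp add: r_def)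
  ultimately show ?case using 0 by simp
qed

section \<open>From Lebesgue to Borel measurability\<close>

text \<open>The Fourier analysis above is carried out for Borel functions over
  \<open>lborel\<close>; this supplies a representative to which it applies.\<close>

lemma lebesgue_measurable_AE_borel:
  fixes g :: "real \<Rightarrow> complex"
  assumes "g \<in> borel_measurable lebesgue"
  obtains g' where "g' \<in> borel_measurable borel" "AE x in lebesgue. g x = g' x"
proof -
  have "(\<lambda>x. Re (g x)) \<in> borel_measurable lebesgue" "(\<lambda>x. Im (g x)) \<in> borel_measurable lebesgue"
    using assms by auto
  from this[THEN completion_ex_borel_measurable_real] obtain a b where
    [measurable]: "a \<in> borel_measurable borel" "b \<in> borel_measurable borel"
    and ab: "AE x in lborel. Re (g x) = a x" "AE x in lborel. Im (g x) = b x"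
    by auto
  have "AE x in lebesgue. g x = Complex (a x) (b x)"
    using ab[THEN AE_completion] by eventually_elim (simp add: complex_eq_iff)
  moreover have "(\<lambda>x. Complex (a x) (b x)) \<in> borel_measurable borel"
    unfolding Complex_eq by measurable
  ultimately show ?thesis using that by blast
qed

lemma integral_lebesgue_cong_AE:
  fixes u v :: "real \<Rightarrow> 'a :: {banach, second_countable_topology}"
  assumes "u \<in> borel_measurable lebesgue" "v \<in> borel_measurable borel" "AE x in lebesgue. u x = v x"
  shows "(LINT x|lebesgue. u x) = (LINT x|lborel. v x)"
proof -
  have v: "v \<in> borel_measurable lebesgue" using assms by (simp add: measurable_completion)
  have "(LINT x|lebesgue. u x) = (LINT x|lebesgue. v x)"
    using assms v by (intro integral_cong_AE) auto
  also have "\<dots> = (LINT x|lborel. v x)"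
    using assms by (intro integral_completion) auto
  finally show ?thesis .
qed

section \<open>Inner products, the equivalence and the norms\<close>

theorem theorem2:
  fixes \<mu> :: "real measure"
    and p :: "nat \<Rightarrow> real poly"
    and g :: "real \<Rightarrow> complex"
    and \<theta> :: "nat \<Rightarrow> real"
  assumes "real_distribution \<mu>"
    and "\<And>n::nat. integrable \<mu> (\<lambda>x. x ^ n)"
    and "infinite (measure_support \<mu>)"
    and "\<And>n. degree (p n) = n"
    and "orthonormal_polys \<mu> p"
    and "g \<in> L2_space"
    and "\<not> (AE \<xi> in lebesgue. g \<xi> = 0)"
    and "\<And>n::nat. ((\<lambda>\<xi>. cmod (complex_of_real (\<xi> ^ n) * g \<xi>)) \<longlongrightarrow> 0) at_infinity"
    and "\<And>n. \<theta> n \<in> {0..<2 * pi}"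
  shows "(\<forall>n. fourier_family p g \<theta> n \<in> L2_space) \<and>
    (orthogonal_family (fourier_family p g \<theta>) \<longleftrightarrow>
       orthogonal_polys (density lebesgue (\<lambda>\<xi>. ennreal ((cmod (g \<xi>))\<^sup>2))) p) \<and>
    (orthogonal_family (fourier_family p g \<theta>) \<longrightarrow>
       orthonormal_family (\<lambda>n x. fourier_family p g \<theta> n x / complex_of_real (L2_nrm g)))"
proof -
  interpret \<mu>: real_distribution \<mu> by fact
  have g_meas [measurable]: "g \<in> borel_measurable lebesgue"
    using \<open>g \<in> L2_space\<close> by (simp add: L2_space_def)
  obtain g' where g' [measurable]: "g' \<in> borel_measurable borel" and gg': "AE x in lebesgue. g x = g' x"
    using lebesgue_measurable_AE_borel[OF g_meas] by blast
  have leb: "(\<lambda>\<xi>. h \<xi> * g \<xi>) \<in> borel_measurable lebesgue"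
    if "h \<in> borel_measurable borel" for h :: "real \<Rightarrow> complex"
  proof (rule borel_measurable_times[OF _ g_meas])
    show "h \<in> borel_measurable lebesgue" using that by (intro measurable_completion) simp
  qed
  \<comment> \<open>Decay is a pointwise condition that the representative \<open>g'\<close> may
    violate, so integrability is shown for \<open>g\<close> and then transferred.\<close>
  have pow: "integrable lborel (\<lambda>\<xi>. (cmod (complex_of_real (\<xi> ^ n) * g' \<xi>))\<^sup>2)" for n
  proof -
    have "integrable lebesgue (\<lambda>\<xi>. (cmod (complex_of_real (\<xi> ^ n) * g' \<xi>))\<^sup>2)"
      using integrable_power_mult_squared[OF assms(6,8), of n]
    proof (rule integrable_cong_AE_imp)
      show "(\<lambda>\<xi>. (cmod (complex_of_real (\<xi> ^ n) * g' \<xi>))\<^sup>2) \<in> borel_measurable lebesgue"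
        by (rule measurable_completion) measurable
      show "AE \<xi> in lebesgue. (cmod (complex_of_real (\<xi> ^ n) * g \<xi>))\<^sup>2 = (cmod (complex_of_real (\<xi> ^ n) * g' \<xi>))\<^sup>2"
        using gg' by eventually_elim simp
    qed
    then show ?thesis by (subst (asm) integrable_completion) auto
  qed
  define f where "f n = (\<lambda>\<xi>. complex_of_real (poly (p n) \<xi>) * g' \<xi>)" for n
  have [measurable]: "f n \<in> borel_measurable borel" for n unfolding f_def by measurable
  have f1: "integrable lborel (f n)" for n
    unfolding f_def by (rule integrable_poly_mult[OF g' pow])
  have f2: "integrable lborel (\<lambda>\<xi>. (cmod (f n \<xi>))\<^sup>2)" for n
    unfolding f_def by (rule integrable_poly_mult_squared[OF g' pow])
  define c where "c n = exp (\<i> * complex_of_real (\<theta> n)) / complex_of_real (sqrt (2 * pi))" for n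
  let ?\<phi> = "fourier_family p g \<theta>"
  have \<phi>: "?\<phi> n = (\<lambda>x. c n * fourier (f n) x)" for n
  proof
    fix x
    have "(LINT \<xi>|lebesgue. iexp (x * \<xi>) * complex_of_real (poly (p n) \<xi>) * g \<xi>) = fourier (f n) x"
      unfolding fourier_def
    proof (rule integral_lebesgue_cong_AE)
      show "AE \<xi> in lebesgue. iexp (x * \<xi>) * complex_of_real (poly (p n) \<xi>) * g \<xi> = iexp (x * \<xi>) * f n \<xi>"
        using gg' by eventually_elim (simp add: f_def)
    qed (intro leb, measurable)
    then show "?\<phi> n x = c n * fourier (f n) x"
      unfolding fourier_family_def c_def by (simp only:)
  qed
  \<comment> \<open>\<open>J\<close> integrates polynomials against
    \<open>\<bar>g\<bar>\<^sup>2\<close>; both orthogonality conditions become the vanishing of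
    \<open>J (p m * p n)\<close> for distinct indices.\<close>
  define J where "J q = (LINT \<xi>|lborel. (cmod (g' \<xi>))\<^sup>2 * poly q \<xi>)" for q :: "real poly"
  have J_int: "integrable lborel (\<lambda>\<xi>. (cmod (g' \<xi>))\<^sup>2 * poly q \<xi>)" for q
  proof -
    have "integrable lborel (\<lambda>\<xi>. Re (cnj (g' \<xi>) * (complex_of_real (poly q \<xi>) * g' \<xi>)))"
      using pow[of 0] by (intro integrable_Re integrable_cnj_mult integrable_poly_mult_squared pow) auto
    moreover have "Re (cnj (g' \<xi>) * (complex_of_real (poly q \<xi>) * g' \<xi>)) = (cmod (g' \<xi>))\<^sup>2 * poly q \<xi>" for \<xi>
      unfolding cmod_power2 by (simp add: power2_eq_square algebra_simps)
    ultimately show ?thesis by (simp only:)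
  qed
  \<comment> \<open>The two factors of modulus \<open>1 / sqrt (2 * pi)\<close> cancel the
    \<open>2 * pi\<close> of Parseval's identity. The remaining phase never vanishes and is 1 on the
    diagonal.\<close>
  have inner: "L2_inner (?\<phi> m) (?\<phi> n) = cis (\<theta> n - \<theta> m) * complex_of_real (J (p m * p n))" for m n
  proof -
    have "L2_inner (?\<phi> m) (?\<phi> n) = (LINT x|lborel. (cnj (c m) * c n) * (cnj (fourier (f m) x) * fourier (f n) x))"
    proof -
      have "cnj (c m * u) * (c n * v) = (cnj (c m) * c n) * (cnj u * v)" for u v
        by simp
      then show ?thesis
        unfolding L2_inner_def \<phi> by (simp only:) (rule integral_completion, measurable)
    qed
    also have "\<dots> = (cnj (c m) * c n) * (2 * pi * (LINT \<xi>|lborel. cnj (f m \<xi>) * f n \<xi>))"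
      by (simp only: integral_mult_right_zero parseval[OF f1 f2 f1 f2])
    also have "(LINT \<xi>|lborel. cnj (f m \<xi>) * f n \<xi>) = complex_of_real (J (p m * p n))"
      unfolding J_def integral_complex_of_real[symmetric] f_def
      by (intro Bochner_Integration.integral_cong)
         (auto simp: complex_norm_square mult_ac simp del: of_real_power)
    also have "cnj (c m) * c n * (2 * pi * complex_of_real (J (p m * p n)))
        = cis (\<theta> n - \<theta> m) * complex_of_real (J (p m * p n))"
    proof -
      have "cnj (c m) * c n = cis (\<theta> n - \<theta> m) / (complex_of_real (sqrt (2 * pi)) * complex_of_real (sqrt (2 * pi)))"
        unfolding c_def by (simp add: cis_conv_exp[symmetric] cis_cnj cis_mult del: of_real_mult)
      also have "complex_of_real (sqrt (2 * pi)) * complex_of_real (sqrt (2 * pi)) = 2 * pi"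
        unfolding of_real_mult[symmetric] by simp
      finally show ?thesis by simp
    qed
    finally show ?thesis .
  qed
  have L2: "?\<phi> n \<in> L2_space" for n
  proof -
    have "integrable lborel (\<lambda>x. (cmod (c n))\<^sup>2 * (cmod (fourier (f n) x))\<^sup>2)"
      by (intro integrable_mult_right integrable_fourier_squared f1 f2)
    moreover have "(\<lambda>x. c n * fourier (f n) x) \<in> borel_measurable lebesgue"
      by (rule measurable_completion) measurable
    ultimately show ?thesis
      unfolding L2_space_def \<phi> by (simp add: integrable_completion norm_mult power_mult_distrib)
  qed
  have poly_leb: "poly q \<in> borel_measurable lebesgue" for q :: "real poly"
    by (rule measurable_completion) simp
  have dens: "(LINT x|density lebesgue (\<lambda>\<xi>. ennreal ((cmod (g \<xi>))\<^sup>2)). poly q x) = J q" for q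
  proof -
    have "(LINT x|density lebesgue (\<lambda>\<xi>. ennreal ((cmod (g \<xi>))\<^sup>2)). poly q x)
        = (LINT x|lebesgue. (cmod (g x))\<^sup>2 * poly q x)"
      using poly_leb by (subst integral_density) auto
    also have "\<dots> = J q"
      unfolding J_def
    proof (rule integral_lebesgue_cong_AE)
      show "(\<lambda>x. (cmod (g x))\<^sup>2 * poly q x) \<in> borel_measurable lebesgue"
        by (intro borel_measurable_times poly_leb) simp
      show "AE x in lebesgue. (cmod (g x))\<^sup>2 * poly q x = (cmod (g' x))\<^sup>2 * poly q x"
        using gg' by eventually_elim simp
    qed measurable
    finally show ?thesis .
  qed
  have orth_iff: "orthogonal_family ?\<phi> \<longleftrightarrow> (\<forall>m n. m \<noteq> n \<longrightarrow> J (p m * p n) = 0)"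
    unfolding orthogonal_family_def inner by simp
  have orth_polys_iff: "orthogonal_polys (density lebesgue (\<lambda>\<xi>. ennreal ((cmod (g \<xi>))\<^sup>2))) p
      \<longleftrightarrow> (\<forall>m n. m \<noteq> n \<longrightarrow> J (p m * p n) = 0)"
    unfolding orthogonal_polys_def poly_mult[symmetric] dens ..
  have nrm: "(L2_nrm g)\<^sup>2 = J 1"
  proof -
    have "J 1 = (LINT x|lebesgue. (cmod (g x))\<^sup>2)"
      unfolding J_def by (rule integral_lebesgue_cong_AE[symmetric])
         (use gg' in \<open>auto elim!: eventually_mono\<close>)
    then show ?thesis by (simp add: L2_nrm_def)
  qed
  \<comment> \<open>This is where \<open>g\<close> not vanishing almost everywhere enters; it makes
    division by \<open>L2_nrm g\<close> meaningful.\<close>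
  have J1: "J 1 \<noteq> 0"
  proof
    assume "J 1 = 0"
    then have "AE \<xi> in lborel. (cmod (g' \<xi>))\<^sup>2 = 0"
      using J_int[of 1] unfolding J_def by (subst (asm) integral_nonneg_eq_0_iff_AE) auto
    then have "AE \<xi> in lebesgue. g' \<xi> = 0" by (intro AE_completion) simp
    with gg' have "AE \<xi> in lebesgue. g \<xi> = 0" by eventually_elim simp
    with assms(7) show False by simp
  qed
  have orthonormal: "orthonormal_family (\<lambda>n x. ?\<phi> n x / complex_of_real (L2_nrm g))" if "orthogonal_family ?\<phi>"
  proof -
    have J0: "J (p m * p n) = 0" if "m \<noteq> n" for m n
      using \<open>orthogonal_family ?\<phi>\<close> that orth_iff by blast
    have \<mu>_int: "integrable \<mu> (poly q)" for q
      unfolding poly_altdef using assms(2) by auto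
    have \<mu>_orth: "(LINT x|\<mu>. poly (p m * p n) x) = (if m = n then 1 else 0)" for m n
      using assms(5) by (simp add: orthonormal_polys_def)
    \<comment> \<open>Since the zero polynomial has degree 0, the degree condition does not exclude
      \<open>p 0 = 0\<close>; normalisation with respect to \<open>\<mu>\<close> does.\<close>
    have p_nz: "p n \<noteq> 0" for n
      using \<mu>_orth[of n n] by auto
    obtain b where b: "p 0 = [:b:]" using assms(4)[of 0] by (rule degree_eq_zeroE)
    have b0: "b \<noteq> 0" using p_nz[of 0] b by auto
    \<comment> \<open>The factor \<open>J 1\<close> is chosen so that \<open>L 1 = 0\<close>, as
      \<open>\<mu>\<close> has total mass 1.\<close>
    define L where "L q = J q - J 1 * (LINT x|\<mu>. poly q x)" for q
    have L_add: "L (q + r) = L q + L r" for q r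
    proof -
      have "(LINT x|\<mu>. poly (q + r) x) = (LINT x|\<mu>. poly q x) + (LINT x|\<mu>. poly r x)"
        unfolding poly_add by (intro Bochner_Integration.integral_add \<mu>_int)
      moreover have "J (q + r) = J q + J r"
        unfolding J_def poly_add distrib_left by (intro Bochner_Integration.integral_add J_int)
      ultimately show ?thesis by (simp add: L_def algebra_simps)
    qed
    have L_smult: "L (smult a q) = a * L q" for a q
    proof -
      have "(LINT x|\<mu>. poly (smult a q) x) = a * (LINT x|\<mu>. poly q x)"
        unfolding poly_smult by (rule integral_mult_right_zero)
      moreover have "J (smult a q) = a * J q"
        unfolding J_def poly_smult mult.left_commute[of _ a] by (rule integral_mult_right_zero)
      ultimately show ?thesis by (simp add: L_def algebra_simps)
    qed
    have L_p: "L (p n) = 0" for n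
    proof (cases "n = 0")
      case True
      have "L (p 0) = b * L 1" unfolding b L_smult[symmetric] by simp
      also have "L 1 = 0" using \<mu>.prob_space by (simp add: L_def)
      finally show ?thesis using True by simp
    next
      case False
      \<comment> \<open>\<open>p 0\<close> is a nonzero constant, so orthogonality to it means that
        both integrals of \<open>p n\<close> vanish.\<close>
      have "L (p 0 * p n) = 0" using \<mu>_orth[of 0 n] J0[of 0 n] False by (simp add: L_def)
      moreover have "L (p 0 * p n) = b * L (p n)" unfolding b L_smult[symmetric] by simp
      ultimately show ?thesis using b0 by simp
    qed
    have "L q = 0" for q
      using linear_functional_eq_0[of L p q] L_add L_smult L_p p_nz assms(4) by blast
    \<comment> \<open>The two functionals now agree up to the factor \<open>J 1\<close> on squares
      too, where \<open>\<mu>\<close> gives the value 1.\<close>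
    from this[of "p n * p n" for n] have Jnn: "J (p n * p n) = J 1" for n
      using \<mu>_orth[of n n] by (simp add: L_def)
    have "L2_inner (\<lambda>x. ?\<phi> m x / complex_of_real (L2_nrm g)) (\<lambda>x. ?\<phi> n x / complex_of_real (L2_nrm g))
        = L2_inner (?\<phi> m) (?\<phi> n) / complex_of_real ((L2_nrm g)\<^sup>2)" for m n
      unfolding L2_inner_def by (simp add: power2_eq_square)
    then show ?thesis
      unfolding orthonormal_family_def by (auto simp: inner nrm J0 Jnn J1)
  qed
  show ?thesis using L2 orth_iff orth_polys_iff orthonormal by blast
qed

end
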